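(* For all constants $\alpha,\beta,\gamma,p\in(0,1)$ there is a positive integer $k=k_{JL}(\alpha,\beta,\gamma,p)$ such that the following holds. For any nonzero vectors $\mathbf{v}_{1},\dots,\mathbf{v}_{n}\in\mathbb{R}^{m}$, let $R$ be a $k\times m$ matrix whose entries are independent standard normal random variables, and let $\mathbf{w}_{i}=\sqrt{1/k}\,R\mathbf{v}_{i}$. Then with probability at least $p$ both of the following hold: (i) $\sum_{i=1}^{n}\frac{\|\mathbf{v}_{i}\|^{2}}{\|\mathbf{w}_{i}\|^{2}}\le(1+\gamma)n$; (ii) $\left|\left\{i:\frac{\|\mathbf{v}_{i}\|^{2}}{\|\mathbf{w}_{i}\|^{2}}<1-\alpha\right\}\right|\le\beta n$.
   Context: $\|\cdot\|$ denotes the Euclidean norm. *)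

theory Defs
  imports "HOL-Probability.Probability" "Jordan_Normal_Form.Matrix"
begin

text \<open>Vectors and matrices are those of \<^theory>\<open>Jordan_Normal_Form.Matrix\<close>, whose dimensions are
  natural numbers: the number \<open>k\<close> of rows is existentially quantified and must not depend on the
  dimension \<open>m\<close>, so dimensions cannot be types.\<close>

no_notation Finite_Cartesian_Product.vec_nth (infixl \<open>$\<close> 90)

definition vec_norm :: "real vec \<Rightarrow> real" where
  "vec_norm v = L2_set (\<lambda>j. v $ j) {..<dim_vec v}"

text \<open>The joint law of the entries of a \<open>k \<times> m\<close> matrix with independent standard normal entries;
  a sample point \<open>\<omega>\<close> is turned into a matrix by \<^term>\<open>mat k m \<omega>\<close>. Using the law instead of
  random variables on a space of polymorphic type keeps \<open>k\<close> from depending on that type.\<close>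

definition std_normal_entries :: "nat \<Rightarrow> nat \<Rightarrow> (nat \<times> nat \<Rightarrow> real) measure" where
  "std_normal_entries k m =
     (\<Pi>\<^sub>M ij \<in> {..<k} \<times> {..<m}. density lborel std_normal_density)"

text \<open>Every random matrix with independent standard normal entries, on any probability space, has
  this joint law. (For \<open>m = 0\<close> there are no nonzero vectors.)\<close>

lemma (in prob_space) distr_std_normal_entries:
  fixes X :: "nat \<times> nat \<Rightarrow> 'a \<Rightarrow> real"
  assumes "0 < k" "0 < m"
    and indep: "indep_vars (\<lambda>_. borel) X ({..<k} \<times> {..<m})"
    and normal: "\<And>ij. ij \<in> {..<k} \<times> {..<m} \<Longrightarrow> distributed M lborel (X ij) std_normal_density"
  shows "distr M (std_normal_entries k m) (\<lambda>\<omega>. \<lambda>ij\<in>{..<k} \<times> {..<m}. X ij \<omega>)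
       = std_normal_entries k m"
proof -
  let ?I = "{..<k} \<times> {..<m}"
  have ne: "?I \<noteq> {}" using assms(1,2) by auto
  have rv: "random_variable borel (X ij)" if "ij \<in> ?I" for ij
    using distributed_measurable[OF normal[OF that]] by simp
  have law: "distr M borel (X ij) = density lborel std_normal_density" if "ij \<in> ?I" for ij
    using distributed_distr_eq_density[OF normal[OF that]]
    by (metis distr_cong sets_lborel)
  have "distr M (\<Pi>\<^sub>M ij\<in>?I. borel) (\<lambda>\<omega>. \<lambda>ij\<in>?I. X ij \<omega>)
      = (\<Pi>\<^sub>M ij\<in>?I. distr M borel (X ij))"
    using indep_vars_iff_distr_eq_PiM'[where I = "{..<k} \<times> {..<m}" and M' = "\<lambda>_. borel" and X = X] ne rv indep by blast
  also have "\<dots> = std_normal_entries k m"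
    unfolding std_normal_entries_def by (intro PiM_cong refl law)
  finally have eq: "distr M (\<Pi>\<^sub>M ij\<in>?I. borel) (\<lambda>\<omega>. \<lambda>ij\<in>?I. X ij \<omega>)
      = std_normal_entries k m" .
  have "sets (std_normal_entries k m) = sets (\<Pi>\<^sub>M ij\<in>?I. (borel :: real measure))"
    unfolding std_normal_entries_def by (intro sets_PiM_cong) auto
  then show ?thesis
    using eq by (metis distr_cong)
qed

end

theory Submission
  imports Defs "HOL-Real_Asymp.Real_Asymp"
begin

text \<open>After normalising \<open>v\<^sub>i\<close>, the ratio \<open>X\<^sub>i = \<parallel>v\<^sub>i\<parallel>\<^sup>2 / \<parallel>w\<^sub>i\<parallel>\<^sup>2\<close> is \<open>k / Q\<close> with \<open>Q\<close> chi-square with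
  \<open>k\<close> degrees of freedom. Integrating the Laplace transform \<open>E exp (- t Q) = (1 + 2 t) powr (- k / 2)\<close>
  over \<open>t \<ge> 0\<close> with weights \<open>1\<close> and \<open>t\<close> yields \<open>E (1 / Q)\<close> and \<open>E (1 / Q\<^sup>2)\<close>; for \<open>k = 2 (l + 3)\<close> this gives
  \<open>E (X\<^sub>i - 1)\<^sup>2 = (l + 5) / ((l + 1) (l + 2))\<close>, which tends to \<open>0\<close>. Both (i) and (ii) follow from
  \<open>\<Sum> \<bar>X\<^sub>i - 1\<bar> \<le> \<delta> n\<close> with \<open>\<delta> = min \<gamma> (\<alpha> \<beta>)\<close>, which in turn follows from
  \<open>\<Sum> (X\<^sub>i - 1)\<^sup>2 \<le> \<delta>\<^sup>2 n\<close>, and Markov's inequality makes the latter likely. No independence between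
  the \<open>X\<^sub>i\<close> is involved.\<close>

section \<open>Integrals over the half-line used for the Laplace transform\<close>

lemma nn_integral_exp_neg:
  fixes q :: real
  assumes "0 < q"
  shows "(\<integral>\<^sup>+t. ennreal (exp (- (t * q))) * indicator {0..} t \<partial>lborel) = ennreal (1 / q)"
proof -
  have "((\<lambda>t. - (exp (- (t * q)) / q)) \<longlongrightarrow> 0) at_top"
    using assms by real_asymp
  then have "(\<integral>\<^sup>+t. ennreal (exp (- (t * q))) * indicator {0..} t \<partial>lborel)
      = 0 - (- (exp (- (0 * q)) / q))"
    using assms by (intro nn_integral_FTC_atLeast) (auto intro!: derivative_eq_intros)
  then show ?thesis by simp
qed

lemma nn_integral_times_exp_neg:
  fixes q :: real
  assumes "0 < q"
  shows "(\<integral>\<^sup>+t. ennreal (t * exp (- (t * q))) * indicator {0..} t \<partial>lborel) = ennreal (1 / q\<^sup>2)"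
proof -
  \<comment> \<open>The antiderivative comes from integration by parts.\<close>
  have "((\<lambda>t. - ((t / q + 1 / q\<^sup>2) * exp (- (t * q)))) \<longlongrightarrow> 0) at_top"
    using assms by real_asymp
  then have "(\<integral>\<^sup>+t. ennreal (t * exp (- (t * q))) * indicator {0..} t \<partial>lborel)
      = 0 - (- ((0 / q + 1 / q\<^sup>2) * exp (- (0 * q))))"
    using assms
    by (intro nn_integral_FTC_atLeast)
       (auto intro!: derivative_eq_intros simp: field_simps power2_eq_square)
  then show ?thesis by simp
qed

text \<open>Writing the exponent as \<open>l + 2\<close> keeps it at least 2, so the antiderivative
  is again an inverse power and vanishes at infinity.\<close>

lemma DERIV_inverse_affine_power:
  fixes t :: real
  assumes "0 \<le> t"
  shows "((\<lambda>t. - (1 / (2 * real (l + 1) * (1 + 2 * t) ^ (l + 1)))) has_real_derivative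
    1 / (1 + 2 * t) ^ (l + 2)) (at t)"
proof -
  have "1 + 2 * t \<noteq> 0" using assms by simp
  then show ?thesis
    by (auto intro!: derivative_eq_intros simp: divide_simps simp flip: of_nat_Suc)
       (cases l; simp add: algebra_simps)
qed

lemma nn_integral_inverse_affine_power:
  "(\<integral>\<^sup>+t. ennreal (1 / (1 + 2 * t) ^ (l + 2)) * indicator {0..} t \<partial>lborel)
    = ennreal (1 / (2 * real (l + 1)))"
proof -
  have "((\<lambda>t. - (1 / (2 * real (l + 1) * (1 + 2 * t) ^ (l + 1)))) \<longlongrightarrow> 0) at_top"
    by real_asymp
  then have "(\<integral>\<^sup>+t. ennreal (1 / (1 + 2 * t) ^ (l + 2)) * indicator {0..} t \<partial>lborel)
      = 0 - (- (1 / (2 * real (l + 1) * (1 + 2 * 0) ^ (l + 1))))"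
    by (intro nn_integral_FTC_atLeast DERIV_inverse_affine_power) auto
  then show ?thesis by simp
qed

text \<open>Since \<open>t = ((1 + 2 * t) - 1) / 2\<close>, the integrand is half the difference of
  two consecutive inverse powers, and the antiderivative \<open>F\<close> of each is known.\<close>

lemma nn_integral_times_inverse_affine_power:
  "(\<integral>\<^sup>+t. ennreal (t * (1 / (1 + 2 * t) ^ (l + 3))) * indicator {0..} t \<partial>lborel)
    = ennreal (1 / (4 * real (l + 1) * real (l + 2)))"
proof -
  define F where "F l t = - (1 / (2 * real (l + 1) * (1 + 2 * t) ^ (l + 1)))" for l t
  have "((\<lambda>t. (F l t - F (l + 1) t) / 2) \<longlongrightarrow> 0) at_top"
    unfolding F_def by real_asymp
  moreover have "((\<lambda>t. (F l t - F (l + 1) t) / 2) has_real_derivative t * (1 / (1 + 2 * t) ^ (l + 3))) (at t)"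
    if "0 \<le> t" for t
  proof -
    have eq: "(1 / x ^ (l + 2) - 1 / x ^ (l + 1 + 2)) / 2 = (x - 1) / 2 * (1 / x ^ (l + 3))"
      if "0 < x" for x :: real
      using that by (simp add: field_simps power_add eval_nat_numeral)
    have "(1 / (1 + 2 * t) ^ (l + 2) - 1 / (1 + 2 * t) ^ (l + 1 + 2)) / 2 = t * (1 / (1 + 2 * t) ^ (l + 3))"
      using eq[of "1 + 2 * t"] that by simp
    then show ?thesis
      unfolding F_def
      using DERIV_cdivide[OF DERIV_diff[OF DERIV_inverse_affine_power[OF that, of l]
            DERIV_inverse_affine_power[OF that, of "l + 1"]], of 2]
      by simp
  qed
  ultimately have "(\<integral>\<^sup>+t. ennreal (t * (1 / (1 + 2 * t) ^ (l + 3))) * indicator {0..} t \<partial>lborel)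
      = 0 - (F l 0 - F (l + 1) 0) / 2"
    by (intro nn_integral_FTC_atLeast) auto
  also have "0 - (F l 0 - F (l + 1) 0) / 2 = 1 / (4 * real (l + 1) * real (l + 2))"
    by (simp add: F_def divide_simps) (simp add: algebra_simps)
  finally show ?thesis .
qed

section \<open>Laplace transform and inverse moments of the chi-square law\<close>

text \<open>The factor \<open>exp (- (t * x\<^sup>2))\<close> merges with the Gaussian exponent: the
  product is \<open>1 / s\<close> times the centred normal density of standard deviation
  \<open>1 / s\<close>, whose integral is 1.\<close>

lemma (in prob_space) nn_integral_exp_neg_square_std_normal:
  assumes Y: "distributed M lborel Y std_normal_density" and "0 \<le> t"
  shows "(\<integral>\<^sup>+\<omega>. ennreal (exp (- (t * (Y \<omega>)\<^sup>2))) \<partial>M) = ennreal (1 / sqrt (1 + 2 * t))"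
proof -
  define s where "s = sqrt (1 + 2 * t)"
  have s: "0 < s" "s\<^sup>2 = 1 + 2 * t" using \<open>0 \<le> t\<close> by (auto simp: s_def)
  have eq: "std_normal_density x * exp (- (t * x\<^sup>2)) = (1 / s) * normal_density 0 (1 / s) x" for x
  proof -
    have "- x\<^sup>2 / 2 - t * x\<^sup>2 = - (x\<^sup>2 * s\<^sup>2 / 2)"
      unfolding s(2) by (simp add: field_simps)
    then have "exp (- x\<^sup>2 / 2) * exp (- (t * x\<^sup>2)) = exp (- (x\<^sup>2 * s\<^sup>2 / 2))"
      by (metis diff_conv_add_uminus exp_add)
    then show ?thesis
      using s(1) by (simp add: normal_density_def real_sqrt_divide power_divide field_simps)
  qed
  have "(\<integral>\<^sup>+\<omega>. ennreal (exp (- (t * (Y \<omega>)\<^sup>2))) \<partial>M)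
      = (\<integral>\<^sup>+x. ennreal (std_normal_density x) * ennreal (exp (- (t * x\<^sup>2))) \<partial>lborel)"
    by (rule distributed_nn_integral[OF Y, symmetric]) simp
  also have "\<dots> = (\<integral>\<^sup>+x. ennreal (1 / s) * ennreal (normal_density 0 (1 / s) x) \<partial>lborel)"
    using s(1) by (intro nn_integral_cong)
      (simp add: ennreal_mult'[symmetric] ennreal_mult''[symmetric] eq normal_density_nonneg)
  also have "\<dots> = ennreal (1 / s) * (\<integral>\<^sup>+x. ennreal (normal_density 0 (1 / s) x) \<partial>lborel)"
    by (rule nn_integral_cmult) simp
  also have "(\<integral>\<^sup>+x. ennreal (normal_density 0 (1 / s) x) \<partial>lborel) = 1"
    using s(1) by (subst nn_integral_eq_integral) (auto simp: normal_density_nonneg)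
  finally show ?thesis by (simp add: s_def)
qed

text \<open>Independence splits the expectation into equal factors. As their number is even, the
  square roots pair up to a natural power.\<close>

lemma (in prob_space) nn_integral_exp_neg_chi_square:
  assumes "finite I" and indep: "indep_vars (\<lambda>_. borel) Y I"
    and normal: "\<And>r. r \<in> I \<Longrightarrow> distributed M lborel (Y r) std_normal_density"
    and card: "card I = 2 * l" and "0 \<le> t"
  shows "(\<integral>\<^sup>+\<omega>. ennreal (exp (- (t * (\<Sum>r\<in>I. (Y r \<omega>)\<^sup>2)))) \<partial>M) = ennreal (1 / (1 + 2 * t) ^ l)"
proof -
  have "(\<integral>\<^sup>+\<omega>. ennreal (exp (- (t * (\<Sum>r\<in>I. (Y r \<omega>)\<^sup>2)))) \<partial>M)
      = (\<integral>\<^sup>+\<omega>. (\<Prod>r\<in>I. ennreal (exp (- (t * (Y r \<omega>)\<^sup>2)))) \<partial>M)"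
    by (simp add: prod_ennreal exp_sum[OF \<open>finite I\<close>] sum_distrib_left sum_negf[symmetric])
  also have "\<dots> = (\<Prod>r\<in>I. \<integral>\<^sup>+\<omega>. ennreal (exp (- (t * (Y r \<omega>)\<^sup>2))) \<partial>M)"
    by (intro indep_vars_nn_integral \<open>finite I\<close>
          indep_vars_compose2[OF indep, where Y = "\<lambda>_ y. ennreal (exp (- (t * y\<^sup>2)))"]) auto
  also have "\<dots> = (\<Prod>r\<in>I. ennreal (1 / sqrt (1 + 2 * t)))"
    by (intro prod.cong refl nn_integral_exp_neg_square_std_normal normal \<open>0 \<le> t\<close>)
  also have "\<dots> = ennreal (1 / (1 + 2 * t) ^ l)"
    using \<open>0 \<le> t\<close> by (simp add: card ennreal_power power_mult power_divide)
  finally show ?thesis .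
qed


text \<open>Tonelli's theorem moves the expectation inside the integral over \<open>t\<close>, where
  it is a Laplace transform. The weight \<open>g\<close> is general so that the first and the second
  inverse moment are both instances.\<close>

lemma (in prob_space) chi_square_Laplace_nn_integral:
  assumes "finite I" and indep: "indep_vars (\<lambda>_. borel) Y I"
    and normal: "\<And>r. r \<in> I \<Longrightarrow> distributed M lborel (Y r) std_normal_density"
    and card: "card I = 2 * l"
    and [measurable]: "g \<in> borel_measurable borel" and g: "\<And>t. 0 \<le> t \<Longrightarrow> 0 \<le> g t"
  shows "(\<integral>\<^sup>+\<omega>. (\<integral>\<^sup>+t. ennreal (g t * exp (- (t * (\<Sum>r\<in>I. (Y r \<omega>)\<^sup>2)))) * indicator {0..} t \<partial>lborel) \<partial>M)
    = (\<integral>\<^sup>+t. ennreal (g t * (1 / (1 + 2 * t) ^ l)) * indicator {0..} t \<partial>lborel)"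
proof -
  interpret pair_sigma_finite M lborel ..
  have [measurable]: "Y r \<in> borel_measurable M" if "r \<in> I" for r
    using distributed_measurable[OF normal[OF that]] by simp
  have "(\<integral>\<^sup>+\<omega>. (\<integral>\<^sup>+t. ennreal (g t * exp (- (t * (\<Sum>r\<in>I. (Y r \<omega>)\<^sup>2)))) * indicator {0..} t \<partial>lborel) \<partial>M)
      = (\<integral>\<^sup>+t. (\<integral>\<^sup>+\<omega>. ennreal (g t * exp (- (t * (\<Sum>r\<in>I. (Y r \<omega>)\<^sup>2)))) * indicator {0..} t \<partial>M) \<partial>lborel)"
    by (rule Fubini'[symmetric]) measurable
  also have "\<dots> = (\<integral>\<^sup>+t. ennreal (g t * (1 / (1 + 2 * t) ^ l)) * indicator {0..} t \<partial>lborel)"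
  proof (intro nn_integral_cong)
    fix t :: real
    show "(\<integral>\<^sup>+\<omega>. ennreal (g t * exp (- (t * (\<Sum>r\<in>I. (Y r \<omega>)\<^sup>2)))) * indicator {0..} t \<partial>M)
        = ennreal (g t * (1 / (1 + 2 * t) ^ l)) * indicator {0..} t"
    proof (cases "0 \<le> t")
      case True
      have "(\<integral>\<^sup>+\<omega>. ennreal (g t * exp (- (t * (\<Sum>r\<in>I. (Y r \<omega>)\<^sup>2)))) * indicator {0..} t \<partial>M)
          = (\<integral>\<^sup>+\<omega>. ennreal (g t) * ennreal (exp (- (t * (\<Sum>r\<in>I. (Y r \<omega>)\<^sup>2)))) \<partial>M)"
        using True by (simp add: ennreal_mult g)
      also have "\<dots> = ennreal (g t) * ennreal (1 / (1 + 2 * t) ^ l)"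
        by (subst nn_integral_cmult)
           (simp_all add: nn_integral_exp_neg_chi_square[OF assms(1-4) True])
      also have "\<dots> = ennreal (g t * (1 / (1 + 2 * t) ^ l))"
        using True by (simp add: ennreal_mult g del: times_divide_eq_right)
      finally show ?thesis using True by simp
    qed simp
  qed
  finally show ?thesis .
qed

text \<open>One coordinate that is almost surely nonzero suffices, and a law with a density gives
  the point 0 no mass.\<close>

lemma (in prob_space) sum_squares_std_normal_pos_AE:
  assumes "finite I" "r \<in> I" "distributed M lborel (Y r) std_normal_density"
  shows "AE \<omega> in M. 0 < (\<Sum>r\<in>I. (Y r \<omega>)\<^sup>2)"
proof -
  have "AE \<omega> in M. Y r \<omega> \<noteq> 0"
    using AE_lborel_singleton[of "0::real"]
    by (subst distributed_AE2[OF assms(3)]) auto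
  then show ?thesis
  proof eventually_elim
    case (elim \<omega>)
    then show ?case using assms(1,2) by (intro sum_pos2[of I r]) auto
  qed
qed

text \<open>The second inverse moment is finite only with more than 4 degrees of freedom;
  \<open>2 * (l + 3)\<close> guarantees at least 6.\<close>

lemma (in prob_space) chi_square_inverse_moments:
  assumes "finite I" and indep: "indep_vars (\<lambda>_. borel) Y I"
    and normal: "\<And>r. r \<in> I \<Longrightarrow> distributed M lborel (Y r) std_normal_density"
    and card: "card I = 2 * (l + 3)"
  defines "Q \<equiv> \<lambda>\<omega>. \<Sum>r\<in>I. (Y r \<omega>)\<^sup>2"
  shows "has_bochner_integral M (\<lambda>\<omega>. 1 / Q \<omega>) (1 / (2 * real (l + 2)))"
    and "has_bochner_integral M (\<lambda>\<omega>. 1 / (Q \<omega>)\<^sup>2) (1 / (4 * real (l + 1) * real (l + 2)))"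
proof -
  have [measurable]: "Y r \<in> borel_measurable M" if "r \<in> I" for r
    using distributed_measurable[OF normal[OF that]] by simp
  have [measurable]: "Q \<in> borel_measurable M" unfolding Q_def by measurable
  have Q0: "0 \<le> Q \<omega>" for \<omega> unfolding Q_def by (simp add: sum_nonneg)
  \<comment> \<open>Where \<open>Q \<omega> = 0\<close>, division yields 0 but the Laplace integrals
    diverge, so the identities below hold only almost everywhere.\<close>
  have pos: "AE \<omega> in M. 0 < Q \<omega>"
  proof -
    obtain r where "r \<in> I" using card by fastforce
    then show ?thesis
      unfolding Q_def using \<open>finite I\<close> normal by (intro sum_squares_std_normal_pos_AE)
  qed
  have "(\<integral>\<^sup>+\<omega>. ennreal (1 / Q \<omega>) \<partial>M)
      = (\<integral>\<^sup>+\<omega>. (\<integral>\<^sup>+t. ennreal (exp (- (t * Q \<omega>))) * indicator {0..} t \<partial>lborel) \<partial>M)"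
    using pos by (intro nn_integral_cong_AE) (auto simp: nn_integral_exp_neg)
  also have "\<dots> = ennreal (1 / (2 * real (l + 2)))"
    using chi_square_Laplace_nn_integral[OF assms(1-4), of "\<lambda>_. 1"]
      nn_integral_inverse_affine_power[of "l + 1"]
    by (simp add: Q_def eval_nat_numeral)
  finally show "has_bochner_integral M (\<lambda>\<omega>. 1 / Q \<omega>) (1 / (2 * real (l + 2)))"
    by (intro has_bochner_integral_nn_integral) (auto simp: Q0)
  have "(\<integral>\<^sup>+\<omega>. ennreal (1 / (Q \<omega>)\<^sup>2) \<partial>M)
      = (\<integral>\<^sup>+\<omega>. (\<integral>\<^sup>+t. ennreal (t * exp (- (t * Q \<omega>))) * indicator {0..} t \<partial>lborel) \<partial>M)"
    using pos by (intro nn_integral_cong_AE) (auto simp: nn_integral_times_exp_neg)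
  also have "\<dots> = ennreal (1 / (4 * real (l + 1) * real (l + 2)))"
    using chi_square_Laplace_nn_integral[OF assms(1-4), of "\<lambda>t. t"]
      nn_integral_times_inverse_affine_power[of l]
    by (simp add: Q_def)
  finally show "has_bochner_integral M (\<lambda>\<omega>. 1 / (Q \<omega>)\<^sup>2) (1 / (4 * real (l + 1) * real (l + 2)))"
    by (intro has_bochner_integral_nn_integral) (auto simp: Q0)
qed

text \<open>Expanding the square leaves only the two inverse moments and a constant.\<close>

lemma (in prob_space) chi_square_inverse_deviation:
  assumes "finite I" and indep: "indep_vars (\<lambda>_. borel) Y I"
    and normal: "\<And>r. r \<in> I \<Longrightarrow> distributed M lborel (Y r) std_normal_density"
    and card: "card I = 2 * (l + 3)"
  shows "has_bochner_integral M (\<lambda>\<omega>. (real (card I) / (\<Sum>r\<in>I. (Y r \<omega>)\<^sup>2) - 1)\<^sup>2)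
    ((real l + 5) / ((real l + 1) * (real l + 2)))"
proof -
  define Q where "Q \<omega> = (\<Sum>r\<in>I. (Y r \<omega>)\<^sup>2)" for \<omega>
  define k where "k = real (card I)"
  have one: "has_bochner_integral M (\<lambda>_. 1) (1::real)"
    by (simp add: has_bochner_integral_iff prob_space)
  note moments = chi_square_inverse_moments[OF assms, folded Q_def]
  have "has_bochner_integral M (\<lambda>\<omega>. k\<^sup>2 * (1 / (Q \<omega>)\<^sup>2) - 2 * k * (1 / Q \<omega>) + 1)
      (k\<^sup>2 * (1 / (4 * real (l + 1) * real (l + 2))) - 2 * k * (1 / (2 * real (l + 2))) + 1)"
    by (intro has_bochner_integral_add has_bochner_integral_diff has_bochner_integral_mult_right
          moments one)
  \<comment> \<open>This holds even where \<open>Q \<omega> = 0\<close>: both sides are then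
    1.\<close>
  moreover have "k\<^sup>2 * (1 / (Q \<omega>)\<^sup>2) - 2 * k * (1 / Q \<omega>) + 1 = (k / Q \<omega> - 1)\<^sup>2" for \<omega>
    by (simp add: power2_diff power_divide)
  moreover have "k\<^sup>2 * (1 / (4 * real (l + 1) * real (l + 2))) - 2 * k * (1 / (2 * real (l + 2))) + 1
      = (real l + 5) / ((real l + 1) * (real l + 2))"
    by (simp add: k_def card divide_simps) (simp add: algebra_simps power2_eq_square)
  ultimately show ?thesis by (simp add: Q_def k_def)
qed

section \<open>Entries and rows of the Gaussian matrix, and the norm ratio\<close>

lemma prob_space_std_normal: "prob_space (density lborel std_normal_density)"
  by (rule prob_space_normal_density) simp

lemma prob_space_std_normal_entries: "prob_space (std_normal_entries k m)"
  unfolding std_normal_entries_def by (intro prob_space_PiM prob_space_std_normal)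

lemma sets_std_normal_entries [measurable_cong]:
  "sets (std_normal_entries k m) = sets (\<Pi>\<^sub>M ij\<in>{..<k} \<times> {..<m}. borel)"
  unfolding std_normal_entries_def by (intro sets_PiM_cong) auto

lemma distributed_std_normal_entry:
  assumes "ij \<in> {..<k} \<times> {..<m}"
  shows "distributed (std_normal_entries k m) lborel (\<lambda>\<omega>. \<omega> ij) std_normal_density"
proof -
  have "distr (std_normal_entries k m) (density lborel std_normal_density) (\<lambda>\<omega>. \<omega> ij)
      = density lborel std_normal_density"
    unfolding std_normal_entries_def using assms
    by (intro distr_PiM_component prob_space_std_normal)
  \<comment> \<open>Only the sigma-algebra of the target matters to \<open>distr\<close>, and the
    density has the same one as \<open>lborel\<close>.\<close>
  moreover have "distr (std_normal_entries k m) lborel (\<lambda>\<omega>. \<omega> ij)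
      = distr (std_normal_entries k m) (density lborel std_normal_density) (\<lambda>\<omega>. \<omega> ij)"
    by (rule distr_cong) auto
  ultimately show ?thesis
    using assms unfolding distributed_def by auto
qed

text \<open>Independence is checked by comparing the joint law with the product of the marginals;
  the joint law of all coordinates is the measure itself.\<close>

lemma indep_vars_std_normal_entries:
  assumes "0 < k" "0 < m"
  shows "prob_space.indep_vars (std_normal_entries k m) (\<lambda>_. borel) (\<lambda>ij \<omega>. \<omega> ij) ({..<k} \<times> {..<m})"
proof -
  interpret prob_space "std_normal_entries k m" by (rule prob_space_std_normal_entries)
  let ?I = "{..<k} \<times> {..<m}" and ?M = "std_normal_entries k m"
  have "distr ?M (\<Pi>\<^sub>M ij\<in>?I. borel) (\<lambda>\<omega>. \<lambda>ij\<in>?I. \<omega> ij) = distr ?M ?M (\<lambda>\<omega>. \<omega>)"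
    by (intro distr_cong refl)
       (simp_all add: sets_std_normal_entries,
        simp add: std_normal_entries_def space_PiM PiE_restrict)
  also have "\<dots> = (\<Pi>\<^sub>M ij\<in>?I. density lborel std_normal_density)"
    by (simp add: distr_id std_normal_entries_def)
  also have "\<dots> = (\<Pi>\<^sub>M ij\<in>?I. distr ?M borel (\<lambda>\<omega>. \<omega> ij))"
  proof (intro PiM_cong refl)
    fix ij assume "ij \<in> ?I"
    then show "density lborel std_normal_density = distr ?M borel (\<lambda>\<omega>. \<omega> ij)"
      using distributed_distr_eq_density[OF distributed_std_normal_entry[of ij k m]]
      by (metis distr_cong sets_lborel)
  qed
  finally show ?thesis
    using assms by (subst indep_vars_iff_distr_eq_PiM') (auto simp: lessThan_empty_iff)
qed

text \<open>Distinct rows read disjoint blocks of entries, hence are independent. Each row gives a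
  combination of independent normals with mean 0 and variance the sum of the squared coefficients,
  here 1.\<close>

lemma std_normal_rows:
  fixes u :: "nat \<Rightarrow> real"
  assumes "0 < k" and unit: "(\<Sum>j<m. (u j)\<^sup>2) = 1"
  defines "Y \<equiv> \<lambda>r \<omega>. \<Sum>j<m. \<omega> (r, j) * u j"
  shows "prob_space.indep_vars (std_normal_entries k m) (\<lambda>_. borel) Y {..<k}"
    and "r < k \<Longrightarrow> distributed (std_normal_entries k m) lborel (Y r) std_normal_density"
proof -
  interpret prob_space "std_normal_entries k m" by (rule prob_space_std_normal_entries)
  have "0 < m" using unit by (cases m) auto
  note indep = indep_vars_std_normal_entries[OF \<open>0 < k\<close> \<open>0 < m\<close>]
  have "indep_vars (\<lambda>r. \<Pi>\<^sub>M ij\<in>{r} \<times> {..<m}. borel) (\<lambda>r \<omega>. \<lambda>ij\<in>{r} \<times> {..<m}. \<omega> ij) {..<k}"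
    by (intro indep_vars_restrict[OF indep]) (auto simp: disjoint_family_on_def)
  then have "indep_vars (\<lambda>_. borel)
      (\<lambda>r \<omega>. \<Sum>j<m. (\<lambda>ij\<in>{r} \<times> {..<m}. \<omega> ij) (r, j) * u j) {..<k}"
    by (rule indep_vars_compose2[where Y = "\<lambda>r \<omega>. \<Sum>j<m. \<omega> (r, j) * u j"]) measurable
  then show "indep_vars (\<lambda>_. borel) Y {..<k}" by (simp add: Y_def)
  assume "r < k"
  \<comment> \<open>A normal density needs a positive standard deviation, so zero coefficients are dropped.\<close>
  define J where "J = {j. j < m \<and> u j \<noteq> 0}"
  have "finite J" "J \<subseteq> {..<m}" by (auto simp: J_def)
  have "J \<noteq> {}"
  proof
    assume "J = {}"
    then have "(\<Sum>j<m. (u j)\<^sup>2) = 0" by (intro sum.neutral) (auto simp: J_def)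
    then show False using unit by simp
  qed
  \<comment> \<open>The summand 0 matches the affine form in
    \<open>normal_density_affine\<close>.\<close>
  have "indep_vars (\<lambda>_. borel) (\<lambda>ij \<omega>. 0 + u (snd ij) * \<omega> ij) ({r} \<times> J)"
    using \<open>r < k\<close> \<open>J \<subseteq> {..<m}\<close>
    by (intro indep_vars_compose2[OF indep_vars_subset[OF indep],
          where Y = "\<lambda>ij y. 0 + u (snd ij) * y"]) auto
  then have "distributed (std_normal_entries k m) lborel
      (\<lambda>\<omega>. \<Sum>ij\<in>{r} \<times> J. 0 + u (snd ij) * \<omega> ij)
      (normal_density (\<Sum>ij\<in>{r} \<times> J. 0 + u (snd ij) * 0) (sqrt (\<Sum>ij\<in>{r} \<times> J. (\<bar>u (snd ij)\<bar> * 1)\<^sup>2)))"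
    using \<open>r < k\<close> \<open>J \<noteq> {}\<close> \<open>finite J\<close>
    by (intro sum_indep_normal normal_density_affine distributed_std_normal_entry)
       (auto simp: J_def)
  moreover have "(\<Sum>ij\<in>{r} \<times> J. (\<bar>u (snd ij)\<bar> * 1)\<^sup>2) = 1"
  proof -
    have "(\<Sum>ij\<in>{r} \<times> J. (\<bar>u (snd ij)\<bar> * 1)\<^sup>2) = (\<Sum>j\<in>J. (u j)\<^sup>2)"
      by (simp add: sum.cartesian_product')
    also have "\<dots> = (\<Sum>j<m. (u j)\<^sup>2)"
      by (rule sum.mono_neutral_left) (auto simp: J_def)
    finally show ?thesis using unit by simp
  qed
  moreover have "(\<Sum>ij\<in>{r} \<times> J. 0 + u (snd ij) * \<omega> ij) = Y r \<omega>" for \<omega>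
  proof -
    have "(\<Sum>ij\<in>{r} \<times> J. 0 + u (snd ij) * \<omega> ij) = (\<Sum>j\<in>J. \<omega> (r, j) * u j)"
      by (simp add: mult.commute sum.cartesian_product')
    also have "\<dots> = Y r \<omega>"
      unfolding Y_def by (rule sum.mono_neutral_left) (auto simp: J_def)
    finally show ?thesis .
  qed
  ultimately show "distributed (std_normal_entries k m) lborel (Y r) std_normal_density"
    by simp
qed

text \<open>Each coordinate of the image is linear in \<open>v\<close>, so the squared norm of
  \<open>v\<close> factors out and cancels. If the remaining sum of squares is 0, both ratios are 0
  by the convention on division, so no sample point is excluded.\<close>

lemma vec_norm_ratio:
  fixes v :: "real vec"
  assumes v: "v \<in> carrier_vec m" "v \<noteq> 0\<^sub>v m"
  defines "u \<equiv> \<lambda>j. v $ j / vec_norm v"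
  shows "(\<Sum>j<m. (u j)\<^sup>2) = 1"
    and "(vec_norm v)\<^sup>2 / (vec_norm (sqrt (1 / real k) \<cdot>\<^sub>v (mat k m \<omega> *\<^sub>v v)))\<^sup>2
      = real k / (\<Sum>r<k. (\<Sum>j<m. \<omega> (r, j) * u j)\<^sup>2)"
proof -
  have dim: "dim_vec v = m" using v by simp
  have sq: "(vec_norm x)\<^sup>2 = (\<Sum>j<dim_vec x. (x $ j)\<^sup>2)" for x
    by (simp add: vec_norm_def L2_set_def sum_nonneg)
  obtain j where "j < m" "v $ j \<noteq> 0"
    using v by (metis carrier_vecD eq_vecI index_zero_vec)
  then have "0 < (vec_norm v)\<^sup>2"
    unfolding sq dim by (intro sum_pos2[of _ j]) auto
  then have N: "vec_norm v \<noteq> 0" by auto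
  have "(\<Sum>j<m. (u j)\<^sup>2) = (\<Sum>j<m. (v $ j)\<^sup>2) / (vec_norm v)\<^sup>2"
    by (simp add: u_def power_divide sum_divide_distrib)
  then show "(\<Sum>j<m. (u j)\<^sup>2) = 1"
    unfolding dim[symmetric] sq[symmetric] using N by simp
  have "(sqrt (1 / real k) \<cdot>\<^sub>v (mat k m \<omega> *\<^sub>v v)) $ r
      = sqrt (1 / real k) * (vec_norm v * (\<Sum>j<m. \<omega> (r, j) * u j))" if "r < k" for r
    using that dim N
    by (simp add: scalar_prod_def u_def sum_distrib_left atLeast0LessThan)
  then have "(vec_norm (sqrt (1 / real k) \<cdot>\<^sub>v (mat k m \<omega> *\<^sub>v v)))\<^sup>2
      = (\<Sum>r<k. (sqrt (1 / real k) * (vec_norm v * (\<Sum>j<m. \<omega> (r, j) * u j)))\<^sup>2)"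
    by (simp add: sq)
  also have "\<dots> = (vec_norm v)\<^sup>2 * (\<Sum>r<k. (\<Sum>j<m. \<omega> (r, j) * u j)\<^sup>2) / real k"
    unfolding sum_distrib_left[of "(vec_norm v)\<^sup>2"] sum_divide_distrib
    by (simp add: power_mult_distrib real_sqrt_divide power_divide)
  finally show "(vec_norm v)\<^sup>2 / (vec_norm (sqrt (1 / real k) \<cdot>\<^sub>v (mat k m \<omega> *\<^sub>v v)))\<^sup>2
      = real k / (\<Sum>r<k. (\<Sum>j<m. \<omega> (r, j) * u j)\<^sup>2)"
    using N by simp
qed


section \<open>Choice of the dimension, and Markov's inequality for the total squared
  deviation\<close>

theorem theorem4p3:
  fixes \<alpha> \<beta> \<gamma> p :: real
  assumes "\<alpha> \<in> {0<..<1}" "\<beta> \<in> {0<..<1}" "\<gamma> \<in> {0<..<1}" "p \<in> {0<..<1}"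
  shows "\<exists>k>0. \<forall>(n::nat) (m::nat) (v :: nat \<Rightarrow> real vec).
    (\<forall>i\<in>{1..n}. v i \<in> carrier_vec m \<and> v i \<noteq> 0\<^sub>v m) \<longrightarrow>
    measure (std_normal_entries k m)
      {\<omega> \<in> space (std_normal_entries k m).
        let R = mat k m \<omega>;
            w = (\<lambda>i. sqrt (1 / real k) \<cdot>\<^sub>v (R *\<^sub>v v i))
        in (\<Sum>i=1..n. (vec_norm (v i))\<^sup>2 / (vec_norm (w i))\<^sup>2) \<le> (1 + \<gamma>) * real n
         \<and> real (card {i\<in>{1..n}. (vec_norm (v i))\<^sup>2 / (vec_norm (w i))\<^sup>2 < 1 - \<alpha>}) \<le> \<beta> * real n}
    \<ge> p"
proof -
  define \<delta> where "\<delta> = min \<gamma> (\<alpha> * \<beta>)"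
  have \<delta>: "0 < \<delta>" "\<delta> \<le> \<gamma>" "\<delta> \<le> \<alpha> * \<beta>"
    using assms by (auto simp: \<delta>_def)
  have "((\<lambda>l. (real l + 5) / ((real l + 1) * (real l + 2))) \<longlongrightarrow> 0) sequentially"
    by real_asymp
  moreover have "0 < (1 - p) * \<delta>\<^sup>2" using assms(4) \<delta> by simp
  \<comment> \<open>Markov's inequality will bound the failure probability by this quotient over
    \<open>\<delta>\<^sup>2\<close>, which must be at most \<open>1 - p\<close>. The choice precedes
    \<open>n\<close>, \<open>m\<close> and \<open>v\<close>.\<close>
  ultimately obtain l where l: "(real l + 5) / ((real l + 1) * (real l + 2)) < (1 - p) * \<delta>\<^sup>2"
    using eventually_happens[OF order_tendstoD(2)] by fastforce
  define k where "k = 2 * (l + 3)"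
  have "0 < k" by (simp add: k_def)
  define \<epsilon> where "\<epsilon> = (real l + 5) / ((real l + 1) * (real l + 2))"
  have "p \<le> measure (std_normal_entries k m)
      {\<omega> \<in> space (std_normal_entries k m).
        let R = mat k m \<omega>;
            w = (\<lambda>i. sqrt (1 / real k) \<cdot>\<^sub>v (R *\<^sub>v v i))
        in (\<Sum>i=1..n. (vec_norm (v i))\<^sup>2 / (vec_norm (w i))\<^sup>2) \<le> (1 + \<gamma>) * real n
         \<and> real (card {i\<in>{1..n}. (vec_norm (v i))\<^sup>2 / (vec_norm (w i))\<^sup>2 < 1 - \<alpha>}) \<le> \<beta> * real n}"
    (is "p \<le> measure _ ?good")
    if v: "\<forall>i\<in>{1..n}. v i \<in> carrier_vec m \<and> v i \<noteq> 0\<^sub>v m" for n m :: nat and v :: "nat \<Rightarrow> real vec"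
  proof -
    define M where "M = std_normal_entries k m"
    interpret prob_space M unfolding M_def by (rule prob_space_std_normal_entries)
    define u where "u i j = v i $ j / vec_norm (v i)" for i j
    define X where "X i \<omega> = real k / (\<Sum>r<k. (\<Sum>j<m. \<omega> (r, j) * u i j)\<^sup>2)" for i \<omega>
    have X_eq: "(vec_norm (v i))\<^sup>2 / (vec_norm (sqrt (1 / real k) \<cdot>\<^sub>v (mat k m \<omega> *\<^sub>v v i)))\<^sup>2 = X i \<omega>"
      if "i \<in> {1..n}" for i \<omega>
      unfolding X_def u_def using v that by (intro vec_norm_ratio(2)) auto
    have unit: "(\<Sum>j<m. (u i j)\<^sup>2) = 1" if "i \<in> {1..n}" for i
      unfolding u_def using v that by (intro vec_norm_ratio(1)) auto
    \<comment> \<open>The cardinality becomes a sum of indicators, which makes the event visibly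
      measurable.\<close>
    have good: "?good = {\<omega> \<in> space M. (\<Sum>i=1..n. X i \<omega>) \<le> (1 + \<gamma>) * real n
        \<and> (\<Sum>i=1..n. if X i \<omega> < 1 - \<alpha> then 1 else 0) \<le> \<beta> * real n}"
      unfolding M_def[symmetric] Let_def
    proof (intro Collect_cong conj_cong refl)
      fix \<omega>
      let ?X = "\<lambda>i. (vec_norm (v i))\<^sup>2 / (vec_norm (sqrt (1 / real k) \<cdot>\<^sub>v (mat k m \<omega> *\<^sub>v v i)))\<^sup>2"
      show "((\<Sum>i=1..n. ?X i) \<le> (1 + \<gamma>) * real n) = ((\<Sum>i=1..n. X i \<omega>) \<le> (1 + \<gamma>) * real n)"
        using X_eq by (metis (no_types, lifting) sum.cong)
      have "{i\<in>{1..n}. ?X i < 1 - \<alpha>} = {i\<in>{1..n}. X i \<omega> < 1 - \<alpha>}"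
        using X_eq by (intro Collect_cong conj_cong refl) simp
      then show "(real (card {i\<in>{1..n}. ?X i < 1 - \<alpha>}) \<le> \<beta> * real n)
          = ((\<Sum>i=1..n. if X i \<omega> < 1 - \<alpha> then 1 else 0) \<le> \<beta> * real n)"
        by (simp add: sum.If_cases Int_def)
    qed
    have [measurable]: "X i \<in> borel_measurable M" for i
      unfolding X_def M_def by measurable
    define S where "S \<omega> = (\<Sum>i=1..n. (X i \<omega> - 1)\<^sup>2)" for \<omega>
    have [measurable]: "S \<in> borel_measurable M"
      unfolding S_def by measurable
    have S_nonneg: "0 \<le> S \<omega>" for \<omega>
      unfolding S_def by (simp add: sum_nonneg)
    have S_good: "\<omega> \<in> ?good" if \<omega>: "\<omega> \<in> space M" "S \<omega> \<le> \<delta>\<^sup>2 * real n" for \<omega>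
    proof -
      \<comment> \<open>This is \<open>2 * x * \<delta> \<le> x\<^sup>2 + \<delta>\<^sup>2\<close>
        divided by \<open>2 * \<delta>\<close>. Summed over \<open>i\<close>, it passes from squared
        to absolute deviations, in place of Cauchy-Schwarz.\<close>
      have "\<bar>X i \<omega> - 1\<bar> \<le> ((X i \<omega> - 1)\<^sup>2 / \<delta> + \<delta>) / 2" for i
        using \<delta>(1) sum_squares_bound[of "\<bar>X i \<omega> - 1\<bar>" \<delta>]
        by (simp add: field_simps power2_eq_square)
      then have "(\<Sum>i=1..n. \<bar>X i \<omega> - 1\<bar>) \<le> (\<Sum>i=1..n. ((X i \<omega> - 1)\<^sup>2 / \<delta> + \<delta>) / 2)"
        by (intro sum_mono)
      also have "\<dots> = (S \<omega> / \<delta> + \<delta> * real n) / 2"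
        by (simp add: S_def sum.distrib flip: sum_divide_distrib)
      also have "\<dots> \<le> \<delta> * real n"
        using \<omega>(2) \<delta>(1) by (simp add: field_simps power2_eq_square)
      finally have dev: "(\<Sum>i=1..n. \<bar>X i \<omega> - 1\<bar>) \<le> \<delta> * real n" .
      have "(\<Sum>i=1..n. X i \<omega>) \<le> (\<Sum>i=1..n. 1 + \<bar>X i \<omega> - 1\<bar>)"
        by (intro sum_mono) simp
      also have "\<dots> \<le> real n + \<delta> * real n"
        using dev by (simp add: sum.distrib)
      also have "\<dots> \<le> (1 + \<gamma>) * real n"
        using \<delta>(2) by (simp add: algebra_simps mult_right_mono)
      finally have "(\<Sum>i=1..n. X i \<omega>) \<le> (1 + \<gamma>) * real n" .
      moreover have "(\<Sum>i=1..n. if X i \<omega> < 1 - \<alpha> then 1 else 0) \<le> \<beta> * real n"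
      proof -
        \<comment> \<open>Every counted index contributes more than \<open>\<alpha>\<close> to the
          total deviation.\<close>
        have "\<alpha> * (\<Sum>i=1..n. if X i \<omega> < 1 - \<alpha> then 1 else 0) \<le> (\<Sum>i=1..n. \<bar>X i \<omega> - 1\<bar>)"
          unfolding sum_distrib_left by (intro sum_mono) auto
        also have "\<dots> \<le> \<alpha> * (\<beta> * real n)"
          using dev mult_right_mono[OF \<delta>(3), of "real n"] by (simp add: mult.assoc)
        finally show ?thesis using assms(1) by simp
      qed
      ultimately show ?thesis using \<omega>(1) unfolding good by simp
    qed
    have "has_bochner_integral M (\<lambda>\<omega>. (X i \<omega> - 1)\<^sup>2) \<epsilon>" if "i \<in> {1..n}" for i
      using chi_square_inverse_deviation[where I = "{..<k}" and l = l
          and Y = "\<lambda>r \<omega>. \<Sum>j<m. \<omega> (r, j) * u i j"]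
        std_normal_rows[OF \<open>0 < k\<close> unit[OF that]]
      by (simp add: X_def \<epsilon>_def k_def M_def)
    then have ES: "has_bochner_integral M S (\<Sum>i=1..n. \<epsilon>)"
      unfolding S_def by (intro has_bochner_integral_sum)
    show "p \<le> measure (std_normal_entries k m) ?good"
    \<comment> \<open>For \<open>n = 0\<close> the Markov threshold
      \<open>\<delta>\<^sup>2 * real n\<close> would be 0, but both conditions hold
      trivially.\<close>
    proof (cases "n = 0")
      case True
      then have "?good = space M" unfolding good by simp
      then show ?thesis using prob_space assms(4) by (simp add: M_def)
    next
      case False
      have "prob {\<omega> \<in> space M. \<delta>\<^sup>2 * real n \<le> S \<omega>} \<le> (\<integral>\<omega>. S \<omega> \<partial>M) / (\<delta>\<^sup>2 * real n)"
        using ES False \<delta>(1)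
        by (intro integral_Markov_inequality_measure[where A = "{}"])
           (auto simp: has_bochner_integral_iff S_nonneg)
      also have "\<dots> = \<epsilon> / \<delta>\<^sup>2"
        using ES False by (simp add: has_bochner_integral_iff)
      also have "\<dots> \<le> 1 - p"
        using l \<delta>(1) unfolding \<epsilon>_def[symmetric] by (simp add: pos_divide_le_eq)
      \<comment> \<open>The complement of the Markov event has \<open>S \<omega>\<close> strictly
        below the threshold, so \<open>S_good\<close> applies there.\<close>
      finally have "p \<le> prob {\<omega> \<in> space M. \<not> \<delta>\<^sup>2 * real n \<le> S \<omega>}"
        by (subst prob_neg) auto
      also have "\<dots> \<le> prob ?good"
      proof (rule finite_measure_mono)
        show "{\<omega> \<in> space M. \<not> \<delta>\<^sup>2 * real n \<le> S \<omega>} \<subseteq> ?good"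
          using S_good by force
        show "?good \<in> events" unfolding good by measurable
      qed
      finally show ?thesis by (simp add: M_def)
    qed
  qed
  then show ?thesis using \<open>0 < k\<close> by blast
qed

end
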